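(* If Condition (B) does not hold at $b$ (resp. at $a$), then the limit $\lim_{\tau\to b}f\in(0,\infty]$ (resp. $\lim_{\tau\to a}f\in(0,\infty]$) exists, and $f'>0$ on $(b-\delta,b)$ for some $\delta>0$ small if $b<\infty$, or on $(M,\infty)$ for some $M>0$ big if $b=\infty$ (resp. $f'<0$ on $(a,a+\delta)$ for some $\delta>0$ if $a>-\infty$, or on $(-\infty,-M)$ for some $M>0$ if $a=-\infty$).
   Context: $(F,g)$ is a connected Riemannian manifold with diameter $\mathrm{diam}(F)\in(0,\infty]$; $I=(a,b)\subseteq\mathbb{R}$ is an open interval, $-\infty\le a<b\le\infty$; $f:I\to(0,\infty)$ is smooth (the warping function of the GRW spacetime $(I\times F,-d\tau^2+f^2g)$). **Turning points.** For a base point $c\in I$ and $D\in\mathbb{R}$ with $1/f^2(c)\ge D$ put $A_+=\{\tau\in(a,b):\tau\ge c,\ 1/f^2(\tau)=D\}\cup\{b\}$ and $A_-=\{\tau\in(a,b):\tau\le c,\ 1/f^2(\tau)=D\}\cup\{a\}$. Define $a_*(D)$, $b_*(D)$: if $\frac{d}{d\tau}\frac1{f^2}(c)>0$, $b_*=\min(A_+\setminus\{c\})$, $a_*=\max A_-$; if it is $<0$, $b_*=\min A_+$, $a_*=\max(A_-\setminus\{c\})$; if it is $0$, $b_*=\min A_+$, $a_*=\max A_-$. **Relative minima at the extremes.** Put $m_b=\liminf_{\tau\to b}1/f^2(\tau)$, $m_a=\liminf_{\tau\to a}1/f^2(\tau)$. The function $1/f^2$ *reaches a relative minimum at $b$*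 if: when $b<\infty$, there is $\epsilon>0$ with $1/f^2(b-\epsilon')>m_b$ for all $0<\epsilon'<\epsilon$; when $b=\infty$, there is $M>0$ with $1/f^2(M')>m_b$ for all $M'>M$. Analogously at $a$ (with $a+\epsilon'$, resp. $-M'$, and $m_a$). A point $c$ is *close to* $b$ if $c\in(b-\epsilon,b)$ (resp. $c>M$) with such $\epsilon$, $M$; analogously for $a$. **The numbers $d_b,d_a$.** If $1/f^2$ reaches a relative minimum at $b$ and $\int_c^b f^{-2}(\frac1{f^2}-m_b)^{-1/2}d\tau<\infty$ for some $c$ close to $b$, $$d_b=\limsup_{D\to m_b}\Big(\int_c^{b_*(D)}f^{-2}\big(\tfrac1{f^2}-D\big)^{-1/2}d\tau\Big)-\int_c^bf^{-2}\big(\tfrac1{f^2}-m_b\big)^{-1/2}d\tau\in[0,\infty]$$ (base point $c$; independent of $c$). Analogously, if $1/f^2$ reaches a relative minimum at $a$ and $\int_a^cf^{-2}(\frac1{f^2}-m_a)^{-1/2}<\infty$, $d_a=\limsup_{D\to m_a}\big(\int_{a_*(D)}^{c}f^{-2}(\frac1{f^2}-D)^{-1/2}\big)-\int_a^cf^{-2}(\frac1{f^2}-m_a)^{-1/2}$. **Condition (B) holds at $b$** if either $1/f^2$ does not reach a relative minimum at $b$, or $\int_c^bf^{-2}(\frac1{f^2}-m_b)^{-1/2}=\infty$ for some $c$ close to $b$, or $2d_b\ge\mathrm{diam}(F)$. **Condition (B) holds at $a$** is the analogous alternative with $\int_a^cf^{-2}(\frac1{f^2}-m_a)^{-1/2}$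 and $d_a$. *)

theory Defs
  imports "HOL-Analysis.Analysis"
begin

section \<open>Smooth maps between open subsets of normed spaces\<close>

fun higher_differentiable_on ::
  "'a::real_normed_vector set \<Rightarrow> ('a \<Rightarrow> 'b::real_normed_vector) \<Rightarrow> nat \<Rightarrow> bool" where
  "higher_differentiable_on S f 0 \<longleftrightarrow> continuous_on S f"
| "higher_differentiable_on S f (Suc n) \<longleftrightarrow>
     (\<forall>x\<in>S. f differentiable (at x)) \<and>
     (\<forall>v. higher_differentiable_on S (\<lambda>x. frechet_derivative f (at x) v) n)"

definition smooth_on ::
  "'a::real_normed_vector set \<Rightarrow> ('a \<Rightarrow> 'b::real_normed_vector) \<Rightarrow> bool" where
  "smooth_on S f \<longleftrightarrow> (\<forall>n. higher_differentiable_on S f n)"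


section \<open>Riemannian manifolds and their diameter\<close>

type_synonym ('p, 'e) chart = "'p set \<times> ('p \<Rightarrow> 'e)"

definition transition :: "('p, 'e) chart \<Rightarrow> ('p, 'e) chart \<Rightarrow> 'e \<Rightarrow> 'e" where
  "transition \<kappa> \<kappa>' = snd \<kappa>' \<circ> inv_into (fst \<kappa>) (snd \<kappa>)"

definition smooth_manifold :: "'p topology \<Rightarrow> ('p, 'e::euclidean_space) chart set \<Rightarrow> bool" where
  "smooth_manifold X \<A> \<longleftrightarrow>
     Hausdorff_space X \<and> second_countable X \<and>
     (\<Union>\<kappa>\<in>\<A>. fst \<kappa>) = topspace X \<and>
     (\<forall>(U, \<phi>)\<in>\<A>. openin X U \<and> open (\<phi> ` U) \<and>
        homeomorphic_map (subtopology X U) (top_of_set (\<phi> ` U)) \<phi>) \<and>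
     (\<forall>(U, \<phi>)\<in>\<A>. \<forall>(V, \<psi>)\<in>\<A>. smooth_on (\<phi> ` (U \<inter> V)) (transition (U, \<phi>) (V, \<psi>)))"

text \<open>
  A metric tensor is given by its coordinate expressions: \<open>g \<kappa> x v w\<close> is the inner product at the
  point with coordinates \<open>x\<close> of the tangent vectors with components \<open>v\<close> and \<open>w\<close>, everything
  with respect to the chart \<open>\<kappa>\<close>. The last clause is the transformation law of a (0,2)-tensor.
\<close>

definition riemannian_metric ::
  "('p, 'e::euclidean_space) chart set \<Rightarrow> (('p, 'e) chart \<Rightarrow> 'e \<Rightarrow> 'e \<Rightarrow> 'e \<Rightarrow> real) \<Rightarrow> bool" where
  "riemannian_metric \<A> g \<longleftrightarrow>
     (\<forall>(U, \<phi>)\<in>\<A>.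
        (\<forall>x\<in>\<phi> ` U. bilinear (g (U, \<phi>) x) \<and>
           (\<forall>v w. g (U, \<phi>) x v w = g (U, \<phi>) x w v) \<and>
           (\<forall>v. v \<noteq> 0 \<longrightarrow> 0 < g (U, \<phi>) x v v)) \<and>
        (\<forall>v w. smooth_on (\<phi> ` U) (\<lambda>x. g (U, \<phi>) x v w)) \<and>
        (\<forall>(V, \<psi>)\<in>\<A>. \<forall>x\<in>\<phi> ` (U \<inter> V). \<forall>v w.
           let T = transition (U, \<phi>) (V, \<psi>); dT = frechet_derivative T (at x)
           in g (U, \<phi>) x v w = g (V, \<psi>) (T x) (dT v) (dT w)))"

definition connected_riemannian_manifold ::
  "'p topology \<Rightarrow> ('p, 'e::euclidean_space) chart set \<Rightarrow>
   (('p, 'e) chart \<Rightarrow> 'e \<Rightarrow> 'e \<Rightarrow> 'e \<Rightarrow> real) \<Rightarrow> bool" where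
  "connected_riemannian_manifold X \<A> g \<longleftrightarrow>
     smooth_manifold X \<A> \<and> riemannian_metric \<A> g \<and> connected_space X"

definition piecewise_C1_curve ::
  "'p topology \<Rightarrow> ('p, 'e::euclidean_space) chart set \<Rightarrow> (real \<Rightarrow> 'p) \<Rightarrow> bool" where
  "piecewise_C1_curve X \<A> \<gamma> \<longleftrightarrow>
     pathin X \<gamma> \<and>
     (\<forall>(U, \<phi>)\<in>\<A>. \<forall>s t. 0 \<le> s \<and> s \<le> t \<and> t \<le> 1 \<and> \<gamma> ` {s..t} \<subseteq> U \<longrightarrow>
        (\<phi> \<circ> \<gamma>) piecewise_C1_differentiable_on {s..t})"

text \<open>
  By the transformation law the speed does not depend on the chart chosen around \<open>\<gamma> t\<close>; it is
  meaningful at all but finitely many \<open>t\<close>, which is enough for the length.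
\<close>

definition curve_speed ::
  "('p, 'e::euclidean_space) chart set \<Rightarrow> (('p, 'e) chart \<Rightarrow> 'e \<Rightarrow> 'e \<Rightarrow> 'e \<Rightarrow> real) \<Rightarrow>
   (real \<Rightarrow> 'p) \<Rightarrow> real \<Rightarrow> real" where
  "curve_speed \<A> g \<gamma> t =
     (let \<kappa> = (SOME \<kappa>. \<kappa> \<in> \<A> \<and> \<gamma> t \<in> fst \<kappa>);
          v = vector_derivative (snd \<kappa> \<circ> \<gamma>) (at t)
      in sqrt (g \<kappa> (snd \<kappa> (\<gamma> t)) v v))"

definition curve_length ::
  "('p, 'e::euclidean_space) chart set \<Rightarrow> (('p, 'e) chart \<Rightarrow> 'e \<Rightarrow> 'e \<Rightarrow> 'e \<Rightarrow> real) \<Rightarrow>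
   (real \<Rightarrow> 'p) \<Rightarrow> ennreal" where
  "curve_length \<A> g \<gamma> = (\<integral>\<^sup>+t\<in>{0..1}. ennreal (curve_speed \<A> g \<gamma> t) \<partial>lborel)"

definition riemannian_dist ::
  "'p topology \<Rightarrow> ('p, 'e::euclidean_space) chart set \<Rightarrow>
   (('p, 'e) chart \<Rightarrow> 'e \<Rightarrow> 'e \<Rightarrow> 'e \<Rightarrow> real) \<Rightarrow> 'p \<Rightarrow> 'p \<Rightarrow> ennreal" where
  "riemannian_dist X \<A> g p q =
     (INF \<gamma>\<in>{\<gamma>. piecewise_C1_curve X \<A> \<gamma> \<and> \<gamma> 0 = p \<and> \<gamma> 1 = q}. curve_length \<A> g \<gamma>)"

definition riemannian_diam ::
  "'p topology \<Rightarrow> ('p, 'e::euclidean_space) chart set \<Rightarrow>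
   (('p, 'e) chart \<Rightarrow> 'e \<Rightarrow> 'e \<Rightarrow> 'e \<Rightarrow> real) \<Rightarrow> ennreal" where
  "riemannian_diam X \<A> g = (SUP p\<in>topspace X. SUP q\<in>topspace X. riemannian_dist X \<A> g p q)"


section \<open>Turning points\<close>

text \<open>
  The interval is \<open>I = einterval a b\<close>, with extended real end points; the warping function is a
  total function of which only the values on \<open>I\<close> are relevant.
\<close>

definition inv_sq :: "(real \<Rightarrow> real) \<Rightarrow> real \<Rightarrow> real" where
  "inv_sq f \<tau> = 1 / (f \<tau>)\<^sup>2"

definition A_plus :: "(real \<Rightarrow> real) \<Rightarrow> ereal \<Rightarrow> ereal \<Rightarrow> real \<Rightarrow> real \<Rightarrow> ereal set" where
  "A_plus f a b c D = ereal ` {\<tau>\<in>einterval a b. c \<le> \<tau> \<and> inv_sq f \<tau> = D} \<union> {b}"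

definition A_minus :: "(real \<Rightarrow> real) \<Rightarrow> ereal \<Rightarrow> ereal \<Rightarrow> real \<Rightarrow> real \<Rightarrow> ereal set" where
  "A_minus f a b c D = ereal ` {\<tau>\<in>einterval a b. \<tau> \<le> c \<and> inv_sq f \<tau> = D} \<union> {a}"

text \<open>
  The minima and maxima exist: the level set is closed in \<open>I\<close>, and \<open>c\<close> is removed only when it is
  an isolated point of it. The definitions are meant for \<open>inv_sq f c \<ge> D\<close>.
\<close>

definition b_star :: "(real \<Rightarrow> real) \<Rightarrow> ereal \<Rightarrow> ereal \<Rightarrow> real \<Rightarrow> real \<Rightarrow> ereal" where
  "b_star f a b c D =
     (if deriv (inv_sq f) c > 0 then (LEAST \<tau>. \<tau> \<in> A_plus f a b c D - {ereal c})
      else (LEAST \<tau>. \<tau> \<in> A_plus f a b c D))"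

definition a_star :: "(real \<Rightarrow> real) \<Rightarrow> ereal \<Rightarrow> ereal \<Rightarrow> real \<Rightarrow> real \<Rightarrow> ereal" where
  "a_star f a b c D =
     (if deriv (inv_sq f) c < 0 then (GREATEST \<tau>. \<tau> \<in> A_minus f a b c D - {ereal c})
      else (GREATEST \<tau>. \<tau> \<in> A_minus f a b c D))"


section \<open>Relative minima at the extremes\<close>

definition m_b :: "(real \<Rightarrow> real) \<Rightarrow> ereal \<Rightarrow> ereal" where
  "m_b f b = Liminf (at_left b) (\<lambda>\<tau>. ereal (inv_sq f (real_of_ereal \<tau>)))"

definition m_a :: "(real \<Rightarrow> real) \<Rightarrow> ereal \<Rightarrow> ereal" where
  "m_a f a = Liminf (at_right a) (\<lambda>\<tau>. ereal (inv_sq f (real_of_ereal \<tau>)))"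

text \<open>
  The number \<open>s\<close> stands for \<open>b - \<epsilon>\<close> if \<open>b < \<infinity>\<close> and for \<open>M\<close> if \<open>b = \<infinity>\<close>; on the other side it
  stands for \<open>a + \<epsilon>\<close> and \<open>-M\<close>, respectively. It is chosen so that the one-sided neighbourhood
  it determines lies in \<open>I\<close>.
\<close>

definition min_threshold_b :: "(real \<Rightarrow> real) \<Rightarrow> ereal \<Rightarrow> ereal \<Rightarrow> real \<Rightarrow> bool" where
  "min_threshold_b f a b s \<longleftrightarrow>
     a \<le> ereal s \<and> ereal s < b \<and> (b = \<infinity> \<longrightarrow> 0 < s) \<and>
     (\<forall>\<tau>\<in>einterval (ereal s) b. m_b f b < ereal (inv_sq f \<tau>))"

definition min_threshold_a :: "(real \<Rightarrow> real) \<Rightarrow> ereal \<Rightarrow> ereal \<Rightarrow> real \<Rightarrow> bool" where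
  "min_threshold_a f a b s \<longleftrightarrow>
     a < ereal s \<and> ereal s \<le> b \<and> (a = -\<infinity> \<longrightarrow> s < 0) \<and>
     (\<forall>\<tau>\<in>einterval a (ereal s). m_a f a < ereal (inv_sq f \<tau>))"

definition reaches_relative_min_b :: "(real \<Rightarrow> real) \<Rightarrow> ereal \<Rightarrow> ereal \<Rightarrow> bool" where
  "reaches_relative_min_b f a b \<longleftrightarrow> (\<exists>s. min_threshold_b f a b s)"

definition reaches_relative_min_a :: "(real \<Rightarrow> real) \<Rightarrow> ereal \<Rightarrow> ereal \<Rightarrow> bool" where
  "reaches_relative_min_a f a b \<longleftrightarrow> (\<exists>s. min_threshold_a f a b s)"

definition close_to_b :: "(real \<Rightarrow> real) \<Rightarrow> ereal \<Rightarrow> ereal \<Rightarrow> real \<Rightarrow> bool" where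
  "close_to_b f a b c \<longleftrightarrow> (\<exists>s. min_threshold_b f a b s \<and> c \<in> einterval (ereal s) b)"

definition close_to_a :: "(real \<Rightarrow> real) \<Rightarrow> ereal \<Rightarrow> ereal \<Rightarrow> real \<Rightarrow> bool" where
  "close_to_a f a b c \<longleftrightarrow> (\<exists>s. min_threshold_a f a b s \<and> c \<in> einterval a (ereal s))"


section \<open>The numbers \<open>d_b\<close> and \<open>d_a\<close>, and Condition (B)\<close>

text \<open>
  Wherever this is used, \<open>inv_sq f \<tau> > D\<close> on the open interval of integration, so neither
  division by zero nor the square root of a negative number is involved.
\<close>

definition travel :: "(real \<Rightarrow> real) \<Rightarrow> real \<Rightarrow> ereal \<Rightarrow> ereal \<Rightarrow> ennreal" where
  "travel f D u v =
     (\<integral>\<^sup>+\<tau>\<in>einterval u v. ennreal (inv_sq f \<tau> * (1 / sqrt (inv_sq f \<tau> - D))) \<partial>lborel)"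

text \<open>
  If \<open>c\<close> is close to \<open>b\<close>, then \<open>0 \<le> m_b f b < \<infinity>\<close>, so \<open>real_of_ereal\<close> is faithful below.
\<close>

definition travel_to_b :: "(real \<Rightarrow> real) \<Rightarrow> ereal \<Rightarrow> real \<Rightarrow> ennreal" where
  "travel_to_b f b c = travel f (real_of_ereal (m_b f b)) (ereal c) b"

definition travel_to_a :: "(real \<Rightarrow> real) \<Rightarrow> ereal \<Rightarrow> real \<Rightarrow> ennreal" where
  "travel_to_a f a c = travel f (real_of_ereal (m_a f a)) a (ereal c)"

definition d_b_at :: "(real \<Rightarrow> real) \<Rightarrow> ereal \<Rightarrow> ereal \<Rightarrow> real \<Rightarrow> ereal" where
  "d_b_at f a b c =
     Limsup (at (real_of_ereal (m_b f b)))
       (\<lambda>D. enn2ereal (travel f D (ereal c) (b_star f a b c D)))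
     - enn2ereal (travel_to_b f b c)"

definition d_a_at :: "(real \<Rightarrow> real) \<Rightarrow> ereal \<Rightarrow> ereal \<Rightarrow> real \<Rightarrow> ereal" where
  "d_a_at f a b c =
     Limsup (at (real_of_ereal (m_a f a)))
       (\<lambda>D. enn2ereal (travel f D (a_star f a b c D) (ereal c)))
     - enn2ereal (travel_to_a f a c)"

text \<open>
  The value does not depend on the base point, so any admissible one may be chosen.
\<close>

definition d_b :: "(real \<Rightarrow> real) \<Rightarrow> ereal \<Rightarrow> ereal \<Rightarrow> ereal" where
  "d_b f a b = d_b_at f a b (SOME c. close_to_b f a b c \<and> travel_to_b f b c < \<infinity>)"

definition d_a :: "(real \<Rightarrow> real) \<Rightarrow> ereal \<Rightarrow> ereal \<Rightarrow> ereal" where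
  "d_a f a b = d_a_at f a b (SOME c. close_to_a f a b c \<and> travel_to_a f a c < \<infinity>)"

definition condition_B_at_b :: "(real \<Rightarrow> real) \<Rightarrow> ereal \<Rightarrow> ereal \<Rightarrow> ennreal \<Rightarrow> bool" where
  "condition_B_at_b f a b diam \<longleftrightarrow>
     \<not> reaches_relative_min_b f a b \<or>
     (\<exists>c. close_to_b f a b c \<and> travel_to_b f b c = \<infinity>) \<or>
     2 * d_b f a b \<ge> enn2ereal diam"

definition condition_B_at_a :: "(real \<Rightarrow> real) \<Rightarrow> ereal \<Rightarrow> ereal \<Rightarrow> ennreal \<Rightarrow> bool" where
  "condition_B_at_a f a b diam \<longleftrightarrow>
     \<not> reaches_relative_min_a f a b \<or>
     (\<exists>c. close_to_a f a b c \<and> travel_to_a f a c = \<infinity>) \<or>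
     2 * d_a f a b \<ge> enn2ereal diam"

end

theory Submission
  imports Defs
begin

text \<open>
  Near \<open>b\<close> put \<open>h = 1/f\<^sup>2\<close>. If \<open>f'\<close> is not eventually positive, there are points \<open>y\<close> arbitrarily
  close to \<open>b\<close> with \<open>h' y \<ge> 0\<close>. The first minimum \<open>t\<close> of \<open>h\<close> on \<open>[c, y]\<close> is then a critical point, the
  energy \<open>D = h t\<close> tends to \<open>m\<^sub>b\<close> as \<open>y\<close> tends to \<open>b\<close>, and \<open>t\<close> is the turning point of \<open>D\<close>. Since
  \<open>h - D\<close> vanishes to second order at \<open>t\<close>, the travel time from \<open>c\<close> to \<open>t\<close> diverges like
  \<open>\<integral> dx / x\<close>. Hence \<open>d\<^sub>b = \<infinity>\<close> and Condition (B) holds. So \<open>f' > 0\<close> near \<open>b\<close>, and the limit exists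
  by monotonicity. The other end point is treated by reflecting \<open>f\<close>.
\<close>

section \<open>Divergence of the travel time at a degenerate turning point\<close>

text \<open>The antiderivative \<open>ln\<close> is unbounded at 0, so compact subintervals of
  \<open>{0<..<\<delta>}\<close> carry arbitrarily large integrals.\<close>

lemma nn_integral_inverse_at_0:
  fixes \<delta> :: real
  assumes "0 < \<delta>"
  shows "(\<integral>\<^sup>+x. ennreal (1 / x) * indicator {0<..<\<delta>} x \<partial>lborel) = \<infinity>"
proof -
  let ?I = "\<integral>\<^sup>+x. ennreal (1 / x) * indicator {0<..<\<delta>} x \<partial>lborel"
  have "ennreal (real n) \<le> ?I" for n
  proof -
    \<comment> \<open>The ratio \<open>q / p = exp n\<close> makes the integral over
      \<open>{p..q}\<close> equal to \<open>n\<close>; the common factor \<open>exp (- 1)\<close>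
      keeps \<open>q\<close> strictly below \<open>\<delta>\<close>.\<close>
    define p where "p = \<delta> * exp (- real n - 1)"
    define q where "q = \<delta> * exp (- 1)"
    have pq: "0 < p" "p \<le> q" "q < \<delta>"
      using assms by (auto simp: p_def q_def)
    have "(\<integral>\<^sup>+x. ennreal (1 / x) * indicator {p..q} x \<partial>lborel) = ennreal (ln q - ln p)"
      using pq by (intro nn_integral_FTC_Icc)
        (auto intro!: derivative_eq_intros simp: has_real_derivative_iff_has_vector_derivative[symmetric])
    moreover have "ln q - ln p = real n"
      using assms by (simp add: p_def q_def ln_mult)
    moreover have "(\<integral>\<^sup>+x. ennreal (1 / x) * indicator {p..q} x \<partial>lborel) \<le> ?I"
      using pq by (intro nn_integral_mono) (auto simp: indicator_def)
    ultimately show ?thesis by simp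
  qed
  then show ?thesis
    by (metis ennreal_of_nat_eq_real_of_nat infinity_ennreal_def ennreal_SUP_of_nat_eq_top SUP_least top.extremum_unique)
qed

text \<open>The substitution \<open>x = t + \<sigma> * y\<close> has Jacobian
  \<open>\<bar>\<sigma>\<bar> = 1\<close> and, as \<open>\<sigma> * \<sigma> = 1\<close>, moves the
  singularity to 0.\<close>

lemma nn_integral_inverse_at:
  fixes \<sigma> t :: real
  assumes "0 < \<delta>" "\<bar>\<sigma>\<bar> = 1"
  shows "(\<integral>\<^sup>+x. ennreal (1 / (\<sigma> * (x - t))) * indicator {0<..<\<delta>} (\<sigma> * (x - t)) \<partial>lborel) = \<infinity>"
proof -
  have "\<sigma> = 1 \<or> \<sigma> = - 1"
    using assms(2) by linarith
  then have "\<sigma> * (t + \<sigma> * x - t) = x" "\<sigma> \<noteq> 0" for x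
    by auto
  then show ?thesis
    using nn_integral_inverse_at_0[OF assms(1)] assms(2)
    by (subst nn_integral_real_affine[where c = \<sigma> and t = t]) (simp_all only:, simp_all)
qed

text \<open>The sign \<open>\<sigma>\<close> selects the side of \<open>t\<close> on which the integration takes place.\<close>

lemma travel_eq_infinity:
  assumes "0 < D" "0 < K" "0 < \<delta>" "\<bar>\<sigma>\<bar> = 1"
    and D: "\<And>x. 0 < \<sigma> * (x - t) \<Longrightarrow> \<sigma> * (x - t) < \<delta> \<Longrightarrow>
      x \<in> einterval u v \<and> D < inv_sq f x \<and> inv_sq f x - D \<le> K * (x - t)\<^sup>2"
  shows "travel f D u v = \<infinity>"
proof -
  \<comment> \<open>The comparison function is \<open>D / (sqrt K * \<bar>x - t\<bar>)\<close>: in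
    the travel integrand the factor \<open>inv_sq f x\<close> is at least \<open>D\<close>, and the
    root is at most \<open>sqrt K * \<bar>x - t\<bar>\<close>.\<close>
  have "\<infinity> = ennreal (D / sqrt K) *
      (\<integral>\<^sup>+x. ennreal (1 / (\<sigma> * (x - t))) * indicator {0<..<\<delta>} (\<sigma> * (x - t)) \<partial>lborel)"
    using assms by (subst nn_integral_inverse_at) (auto simp: ennreal_mult_eq_top_iff)
  also have "\<dots> = (\<integral>\<^sup>+x. ennreal (D / sqrt K) * (ennreal (1 / (\<sigma> * (x - t))) *
      indicator {0<..<\<delta>} (\<sigma> * (x - t))) \<partial>lborel)"
    by (subst nn_integral_cmult) auto
  also have "\<dots> \<le> travel f D u v"
    unfolding travel_def
  proof (rule nn_integral_mono)
    fix x
    show "ennreal (D / sqrt K) * (ennreal (1 / (\<sigma> * (x - t))) * indicator {0<..<\<delta>} (\<sigma> * (x - t)))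
      \<le> ennreal (inv_sq f x * (1 / sqrt (inv_sq f x - D))) * indicator (einterval u v) x"
    proof (cases "\<sigma> * (x - t) \<in> {0<..<\<delta>}")
      case True
      then have y: "0 < \<sigma> * (x - t)" and x: "x \<in> einterval u v" "D < inv_sq f x"
        "inv_sq f x - D \<le> K * (x - t)\<^sup>2"
        using D by auto
      have "\<sigma>\<^sup>2 = 1"
        using assms(4) by (metis one_power2 power2_abs)
      then have "(x - t)\<^sup>2 = (\<sigma> * (x - t))\<^sup>2"
        by (simp add: power_mult_distrib)
      then have "sqrt (inv_sq f x - D) \<le> sqrt (K * (\<sigma> * (x - t))\<^sup>2)"
        using x(3) by simp
      also have "\<dots> = sqrt K * (\<sigma> * (x - t))"
        using y by (simp add: real_sqrt_mult)
      finally have le: "sqrt (inv_sq f x - D) \<le> sqrt K * (\<sigma> * (x - t))" .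
      have "D / sqrt K * (1 / (\<sigma> * (x - t))) = D * (1 / (sqrt K * (\<sigma> * (x - t))))"
        by simp
      also have "\<dots> \<le> inv_sq f x * (1 / sqrt (inv_sq f x - D))"
        using le x(2) y assms(1,2) by (intro mult_mono frac_le) auto
      finally have "ennreal (D / sqrt K * (1 / (\<sigma> * (x - t)))) \<le>
          ennreal (inv_sq f x * (1 / sqrt (inv_sq f x - D)))"
        by (rule ennreal_leI)
      moreover have "ennreal (D / sqrt K) * ennreal (1 / (\<sigma> * (x - t))) =
          ennreal (D / sqrt K * (1 / (\<sigma> * (x - t))))"
        using y assms(1,2) by (subst ennreal_mult) auto
      ultimately show ?thesis
        using True x(1) by (simp only: indicator_simps mult_1_right)
    qed simp
  qed
  finally show ?thesis
    by (simp add: top.extremum_unique)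
qed

text \<open>A Taylor estimate from the derivative of \<open>h'\<close> at the single point
  \<open>t\<close>: since \<open>h' t = 0\<close>, near \<open>t\<close> the size of
  \<open>h'\<close> is at most \<open>K\<close> times the distance to \<open>t\<close>, and the mean
  value inequality contributes the second factor.\<close>

lemma quadratic_bound_at_critical_point:
  fixes h h' :: "real \<Rightarrow> real"
  assumes S: "open S" "t \<in> S" "\<And>x. x \<in> S \<Longrightarrow> (h has_real_derivative h' x) (at x)"
    and t: "(h' has_real_derivative l) (at t)" "h' t = 0"
  obtains K \<delta> where "0 < K" "0 < \<delta>" "\<And>x. \<bar>x - t\<bar> < \<delta> \<Longrightarrow> x \<in> S \<and> \<bar>h x - h t\<bar> \<le> K * (x - t)\<^sup>2"
proof -
  \<comment> \<open>Near \<open>t\<close> the difference quotient of \<open>h'\<close> differs from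
    \<open>l\<close> by less than 1.\<close>
  define K where "K = \<bar>l\<bar> + 1"
  obtain r where r: "0 < r" "\<And>x. \<bar>x - t\<bar> < r \<Longrightarrow> x \<in> S"
    using S(1,2) unfolding open_dist dist_real_def by blast
  have "((\<lambda>y. h' y / (y - t)) \<longlongrightarrow> l) (at t)"
    using t by (simp add: has_field_derivative_iff)
  then have "\<forall>\<^sub>F y in at t. dist (h' y / (y - t)) l < 1"
    by (rule tendstoD) simp
  then obtain d where d: "0 < d" "\<And>y. y \<noteq> t \<Longrightarrow> \<bar>y - t\<bar> < d \<Longrightarrow> \<bar>h' y / (y - t) - l\<bar> < 1"
    unfolding eventually_at dist_real_def by auto
  have h': "\<bar>h' y\<bar> \<le> K * \<bar>y - t\<bar>" if "\<bar>y - t\<bar> < d" for y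
  proof (cases "y = t")
    case False
    with d(2)[OF False that] have "\<bar>h' y / (y - t)\<bar> \<le> K"
      unfolding K_def by linarith
    with False show ?thesis
      by (simp add: divide_simps)
  qed (simp add: t)
  show thesis
  proof
    show "0 < K" "0 < min r d"
      using r d by (auto simp: K_def)
    fix x assume x: "\<bar>x - t\<bar> < min r d"
    have seg: "\<bar>z - t\<bar> \<le> \<bar>x - t\<bar>" if "z \<in> closed_segment t x" for z
      using that by (auto simp: closed_segment_eq_real_ivl split: if_splits)
    have "norm (h x - h t) \<le> (K * \<bar>x - t\<bar>) * norm (x - t)"
    proof (rule field_differentiable_bound[where f' = h'])
      show "convex (closed_segment t x)" "x \<in> closed_segment t x" "t \<in> closed_segment t x"
        by auto
      fix z assume z: "z \<in> closed_segment t x"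
      show "(h has_field_derivative h' z) (at z within closed_segment t x)"
        using seg[OF z] x by (intro DERIV_subset[OF S(3)] r(2)) auto
      have "\<bar>h' z\<bar> \<le> K * \<bar>z - t\<bar>"
        using seg[OF z] x by (intro h') auto
      also have "\<dots> \<le> K * \<bar>x - t\<bar>"
        using seg[OF z] by (intro mult_left_mono) (auto simp: K_def)
      finally show "norm (h' z) \<le> K * \<bar>x - t\<bar>" by simp
    qed
    also have "K * \<bar>x - t\<bar> * norm (x - t) = K * (x - t)\<^sup>2"
      by (simp add: power2_eq_square mult.assoc)
    finally show "x \<in> S \<and> \<bar>h x - h t\<bar> \<le> K * (x - t)\<^sup>2"
      using r(2) x by simp
  qed
qed


section \<open>Existence of degenerate turning points\<close>

text \<open>A minimiser in the interior of \<open>{c..y}\<close> is critical by Fermat; at the right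
  end \<open>y\<close>, minimality excludes \<open>0 < h' y\<close>, while \<open>y\<close> is
  chosen with \<open>0 \<le> h' y\<close>. Taking the first minimiser makes the inequality on its
  left strict, so it is the first point of its level set from \<open>c\<close> onwards.\<close>

lemma first_minimum_is_critical:
  fixes h h' :: "real \<Rightarrow> real" and b :: ereal
  assumes cb: "ereal c < b"
    and deriv: "\<And>x. c \<le> x \<Longrightarrow> ereal x < b \<Longrightarrow> (h has_real_derivative h' x) (at x)"
    and low: "\<exists>x>c. ereal x < b \<and> h x < B" and B: "B \<le> h c"
    and nonneg: "\<And>s. ereal s < b \<Longrightarrow> \<exists>x>s. ereal x < b \<and> 0 \<le> h' x"
  obtains t where "c < t" "ereal t < b" "h t < B" "h' t = 0" "\<And>x. c \<le> x \<Longrightarrow> x < t \<Longrightarrow> h t < h x"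
proof -
  obtain x where x: "c < x" "ereal x < b" "h x < B"
    using low by blast
  \<comment> \<open>As \<open>y\<close> lies beyond \<open>x\<close>, the minimum over
    \<open>{c..y}\<close> is at most \<open>h x\<close>, hence below \<open>B \<le> h c\<close>;
    this excludes \<open>c\<close> as a minimiser.\<close>
  obtain y where y: "x < y" "ereal y < b" "0 \<le> h' y"
    using nonneg[OF x(2)] by blast
  have deriv': "(h has_real_derivative h' z) (at z)" if "z \<in> {c..y}" for z
    using that y(2) by (intro deriv) (auto intro: le_less_trans[of "ereal z" "ereal y"])
  have cont: "continuous_on {c..y} h"
    using deriv' by (intro DERIV_continuous_on[where D = h']) (auto intro: DERIV_subset)
  obtain z where z: "z \<in> {c..y}" "\<And>w. w \<in> {c..y} \<Longrightarrow> h z \<le> h w"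
    using continuous_attains_inf[OF _ _ cont] x y by auto
  \<comment> \<open>The set of all minimisers is compact, so there is a first one.\<close>
  define Z where "Z = {c..y} \<inter> h -` {h z}"
  have "compact Z"
    unfolding Z_def
    using continuous_closed_preimage[OF cont closed_atLeastAtMost closed_singleton[of "h z"]]
    by (metis compact_Icc closed_Int_compact compact_Int_closed inf.idem inf.assoc)
  moreover have "z \<in> Z"
    using z by (simp add: Z_def)
  ultimately obtain t where t: "t \<in> Z" "\<And>w. w \<in> Z \<Longrightarrow> t \<le> w"
    using compact_attains_inf[of Z] by blast
  have tcy: "t \<in> {c..y}" and ht: "h t = h z"
    using t by (auto simp: Z_def)
  have min: "h t \<le> h w" if "w \<in> {c..y}" for w
    using z that ht by simp
  have tB: "h t < B"
    using min[of x] x y by auto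
  have ct: "c < t"
    using tB B tcy by (cases "t = c") auto
  show thesis
  proof
    show "c < t" "h t < B" by fact+
    show "ereal t < b"
      using tcy y(2) by (auto intro: le_less_trans[of "ereal t" "ereal y"])
    show "h t < h x" if "c \<le> x" "x < t" for x
    proof -
      have "x \<in> {c..y}" "x \<notin> Z"
        using that tcy t(2)[of x] by auto
      then show ?thesis
        using min[of x] ht by (auto simp: Z_def)
    qed
    show "h' t = 0"
    proof (cases "t = y")
      case False
      have "h t \<le> h w" if "\<bar>t - w\<bar> < min (t - c) (y - t)" for w
        using that by (intro min) auto
      then show ?thesis
        using False ct tcy deriv'[OF tcy]
        by (intro DERIV_local_min[where d = "min (t - c) (y - t)" and x = t]) auto
    next
      case True
      have "\<not> 0 < h' t"
      proof
        assume "0 < h' t"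
        then obtain d where d: "0 < d" "\<And>k. 0 < k \<Longrightarrow> k < d \<Longrightarrow> h (t - k) < h t"
          using DERIV_pos_inc_left[OF deriv'[OF tcy]] by blast
        have "h (t - min (d/2) (t - c)) < h t"
          using d ct by (intro d(2)) auto
        moreover have "h t \<le> h (t - min (d/2) (t - c))"
          using d ct tcy by (intro min) auto
        ultimately show False by simp
      qed
      then show ?thesis
        using y(3) True by simp
    qed
  qed
qed

section \<open>Behaviour of the warping function near the right end point\<close>

lemma Liminf_at_left_less:
  fixes b :: ereal and g :: "ereal \<Rightarrow> ereal"
  assumes "Liminf (at_left b) g < C" "s < b"
  shows "\<exists>\<tau>>s. \<tau> < b \<and> g \<tau> < C"
proof (rule ccontr)
  assume "\<not> ?thesis"
  then have "\<forall>\<^sub>F \<tau> in at_left b. C \<le> g \<tau>"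
    unfolding eventually_at_left[OF assms(2)] using assms(2) by (metis not_less)
  from Liminf_bounded[OF this] assms(1) show False by simp
qed

lemma m_b_nonneg: "0 \<le> m_b f b"
  unfolding m_b_def by (rule Liminf_bounded) (auto simp: inv_sq_def)

text \<open>The threshold lies to the left of \<open>c\<close>, so its strict inequality holds on
  all of \<open>[c, b)\<close>. The lower limit is nonnegative and below \<open>inv_sq f c\<close>,
  hence finite.\<close>

lemma close_to_bD:
  assumes "close_to_b f a b c"
  shows "c \<in> einterval a b"
    and "\<bar>m_b f b\<bar> \<noteq> \<infinity>"
    and "\<And>x. c \<le> x \<Longrightarrow> ereal x < b \<Longrightarrow> x \<in> einterval a b \<and> real_of_ereal (m_b f b) < inv_sq f x"
proof -
  obtain s where s: "a \<le> ereal s" "ereal s < ereal c" "ereal c < b"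
      "\<And>\<tau>. \<tau> \<in> einterval (ereal s) b \<Longrightarrow> m_b f b < ereal (inv_sq f \<tau>)"
    using assms by (auto simp: close_to_b_def min_threshold_b_def einterval_iff[of c])
  show "c \<in> einterval a b"
    using s by (auto simp: einterval_iff intro: le_less_trans)
  show fin: "\<bar>m_b f b\<bar> \<noteq> \<infinity>"
    using s(4)[of c] s(2,3) m_b_nonneg[of f b] by (auto simp: einterval_iff)
  fix x assume x: "c \<le> x" "ereal x < b"
  then have sx: "ereal s < ereal x"
    using s(2) by simp
  then show "x \<in> einterval a b \<and> real_of_ereal (m_b f b) < inv_sq f x"
    using s(1) s(4)[of x] x fin by (cases "m_b f b") (auto simp: einterval_iff intro: le_less_trans)
qed

text \<open>The derivatives are parameters, so that the reflected function is an instance of the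
  same locale with explicit derivatives. The second one enters through the quadratic bound at
  critical points of \<open>inv_sq f\<close>.\<close>

locale C2_warping =
  fixes f f' f'' :: "real \<Rightarrow> real" and a b :: ereal
  assumes f_pos: "\<tau> \<in> einterval a b \<Longrightarrow> 0 < f \<tau>"
    and f_deriv: "\<tau> \<in> einterval a b \<Longrightarrow> (f has_real_derivative f' \<tau>) (at \<tau>)"
    and f'_deriv: "\<tau> \<in> einterval a b \<Longrightarrow> (f' has_real_derivative f'' \<tau>) (at \<tau>)"
begin

lemma inv_sq_pos: "\<tau> \<in> einterval a b \<Longrightarrow> 0 < inv_sq f \<tau>"
  using f_pos[of \<tau>] by (simp add: inv_sq_def)

lemma inv_sq_deriv:
  assumes "\<tau> \<in> einterval a b"
  shows "(inv_sq f has_real_derivative - 2 * f' \<tau> / f \<tau> ^ 3) (at \<tau>)"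
proof -
  have "((\<lambda>\<tau>. 1 / (f \<tau>)\<^sup>2) has_real_derivative - 2 * f' \<tau> / f \<tau> ^ 3) (at \<tau>)"
    using f_pos[OF assms]
    by (auto intro!: derivative_eq_intros f_deriv assms simp: field_simps eval_nat_numeral)
  then show ?thesis
    by (simp add: inv_sq_def[abs_def])
qed

lemma inv_sq_deriv2:
  assumes "\<tau> \<in> einterval a b"
  obtains l where "((\<lambda>\<tau>. - 2 * f' \<tau> / f \<tau> ^ 3) has_real_derivative l) (at \<tau>)"
proof -
  have "(\<lambda>\<tau>. - 2 * f' \<tau> / f \<tau> ^ 3) differentiable (at \<tau>)"
    using f_pos[OF assms] f_deriv[OF assms] f'_deriv[OF assms]
    by (intro derivative_intros) (auto simp: real_differentiable_def)
  then show thesis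
    using that by (auto simp: real_differentiable_def)
qed

text \<open>The derivative of \<open>inv_sq f\<close> has the sign opposite to \<open>f'\<close>, so
  points with \<open>f' x \<le> 0\<close> near \<open>b\<close> supply the points of nonnegative
  slope required for a critical first minimum. The parameter \<open>e\<close> lets the energy
  \<open>inv_sq f t\<close> approach the lower limit from above.\<close>

lemma degenerate_turning_point:
  assumes close: "close_to_b f a b c"
    and nonpos: "\<And>s. ereal s < b \<Longrightarrow> \<exists>x>s. ereal x < b \<and> f' x \<le> 0"
    and e: "0 < e"
  obtains t K \<delta> where "c < t" "t \<in> einterval a b"
    "inv_sq f t < real_of_ereal (m_b f b) + e" "real_of_ereal (m_b f b) < inv_sq f t"
    "\<And>x. c \<le> x \<Longrightarrow> x < t \<Longrightarrow> inv_sq f t < inv_sq f x"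
    "0 < K" "0 < \<delta>" "\<And>x. \<bar>x - t\<bar> < \<delta> \<Longrightarrow> \<bar>inv_sq f x - inv_sq f t\<bar> \<le> K * (x - t)\<^sup>2"
proof -
  note close_to_bD[OF close]
  note c = this(1) and m = this(2) and gt = this(3)
  let ?m = "real_of_ereal (m_b f b)"
  let ?h' = "\<lambda>\<tau>. - 2 * f' \<tau> / f \<tau> ^ 3"
  \<comment> \<open>The first bound forces the energy close to the lower limit; the second keeps the
    minimum away from \<open>c\<close>.\<close>
  define B where "B = min (?m + e) (inv_sq f c)"
  have cb: "ereal c < b"
    using c by (simp add: einterval_iff)
  have mB: "m_b f b < ereal B"
    using m e gt[of c] cb by (cases "m_b f b") (auto simp: B_def min_def)
  obtain \<tau> where \<tau>: "ereal c < \<tau>" "\<tau> < b" "ereal (inv_sq f (real_of_ereal \<tau>)) < ereal B"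
    using Liminf_at_left_less[OF mB[unfolded m_b_def] cb] by blast
  obtain t where t: "c < t" "ereal t < b" "inv_sq f t < B" "?h' t = 0"
      "\<And>x. c \<le> x \<Longrightarrow> x < t \<Longrightarrow> inv_sq f t < inv_sq f x"
  proof (rule first_minimum_is_critical[OF cb, where h = "inv_sq f" and h' = ?h' and B = B])
    show "(inv_sq f has_real_derivative ?h' x) (at x)" if "c \<le> x" "ereal x < b" for x
      using inv_sq_deriv gt that by blast
    show "\<exists>x>c. ereal x < b \<and> inv_sq f x < B"
      using \<tau> by (cases \<tau>) auto
    show "B \<le> inv_sq f c"
      by (simp add: B_def)
    show "\<exists>x>s. ereal x < b \<and> 0 \<le> ?h' x" if s: "ereal s < b" for s
    proof -
      \<comment> \<open>Searching beyond \<open>c\<close> ensures that the point lies in the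
        interval, where \<open>f\<close> is positive.\<close>
      have "ereal (max c s) < b"
        using s cb by (simp add: max_def)
      then obtain x where x: "max c s < x" "ereal x < b" "f' x \<le> 0"
        using nonpos by blast
      then have "0 < f x"
        using gt[of x] f_pos by auto
      then have "0 \<le> ?h' x"
        using x(3) by (auto intro: divide_nonpos_pos)
      then show ?thesis
        using x by auto
    qed
  qed (blast intro: that)
  have tI: "t \<in> einterval a b" and tm: "?m < inv_sq f t"
    using gt[of t] t by auto
  obtain l where l: "(?h' has_real_derivative l) (at t)"
    using inv_sq_deriv2[OF tI] by blast
  obtain K \<delta> where K: "0 < K" "0 < \<delta>"
      "\<And>x. \<bar>x - t\<bar> < \<delta> \<Longrightarrow> x \<in> einterval a b \<and> \<bar>inv_sq f x - inv_sq f t\<bar> \<le> K * (x - t)\<^sup>2"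
    using quadratic_bound_at_critical_point[OF open_einterval tI inv_sq_deriv l t(4)] by blast
  show thesis
    using that[OF t(1) tI _ tm t(5) K(1,2)] K(3) t(3) by (simp add: B_def)
qed

end


section \<open>Reflection\<close>

text \<open>Negation is an order-reversing homeomorphism of the extended reals.\<close>

lemma at_right_ereal_eq: "at_right (a::ereal) = filtermap uminus (at_left (- a))"
proof (rule filter_eqI)
  fix P :: "ereal \<Rightarrow> bool"
  \<comment> \<open>Stated for arbitrary \<open>x\<close>, \<open>T\<close> and \<open>Q\<close>
    because it is used twice, from \<open>a\<close> to \<open>- a\<close> and back.\<close>
  have 1: "\<exists>S. open S \<and> - x \<in> S \<and> (\<forall>y\<in>S. y \<noteq> - x \<longrightarrow> - y \<in> T \<longrightarrow> Q (- y))"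
    if "open S" "x \<in> S" "\<forall>y\<in>S. y \<noteq> x \<longrightarrow> y \<in> T \<longrightarrow> Q y" for x :: ereal and S T Q
    using that by (intro exI[of _ "uminus ` S"]) (auto intro: ereal_open_uminus)
  show "eventually P (at_right a) \<longleftrightarrow> eventually P (filtermap uminus (at_left (- a)))"
    using 1[of _ a "{a<..}" P] 1[of _ "- a" "{..<- a}" "\<lambda>x. P (- x)"]
    unfolding eventually_filtermap eventually_at_topological
    by (auto simp: ereal_uminus_less_reorder ereal_less_uminus_reorder)
qed

lemma inv_sq_reflect: "inv_sq (\<lambda>x. f (- x)) x = inv_sq f (- x)"
  by (simp add: inv_sq_def)

lemma m_b_reflect: "m_b (\<lambda>x. f (- x)) (- a) = m_a f a"
  unfolding m_a_def m_b_def at_right_ereal_eq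
  by (subst Liminf_filtermap_eq) (auto simp: inj_on_def inv_sq_reflect)

lemma einterval_reflect: "x \<in> einterval (- b) (- a) \<longleftrightarrow> - x \<in> einterval a b"
  by (cases a; cases b) (auto simp: einterval_iff)

lemma min_threshold_reflect:
  "min_threshold_b (\<lambda>x. f (- x)) (- b) (- a) (- s) \<longleftrightarrow> min_threshold_a f a b s"
proof -
  have "(\<forall>\<tau>\<in>einterval (ereal (- s)) (- a). m_a f a < ereal (inv_sq f (- \<tau>))) \<longleftrightarrow>
      (\<forall>\<tau>\<in>einterval a (ereal s). m_a f a < ereal (inv_sq f \<tau>))"
    using einterval_reflect[of _ "ereal s" a] by (metis minus_minus uminus_ereal.simps(1))
  moreover have "(- a = \<infinity> \<longrightarrow> 0 < - s) \<longleftrightarrow> (a = - \<infinity> \<longrightarrow> s < 0)"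
    by (cases a) auto
  moreover have "- b \<le> ereal (- s) \<longleftrightarrow> ereal s \<le> b" "ereal (- s) < - a \<longleftrightarrow> a < ereal s"
    by (cases b; simp) (cases a; simp)
  ultimately show ?thesis
    unfolding min_threshold_b_def min_threshold_a_def m_b_reflect inv_sq_reflect by blast
qed

lemma close_to_reflect: "close_to_b (\<lambda>x. f (- x)) (- b) (- a) (- c) \<longleftrightarrow> close_to_a f a b c"
proof -
  have "- c \<in> einterval (ereal (- s)) (- a) \<longleftrightarrow> c \<in> einterval a (ereal s)" for s
    using einterval_reflect[of "- c" "ereal s" a] by simp
  then show ?thesis
    unfolding close_to_b_def close_to_a_def
    using min_threshold_reflect[of f b a] by (metis minus_minus)
qed

text \<open>Each differentiation contributes one sign, so the first derivative changes sign and the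
  second does not.\<close>

lemma (in C2_warping) reflect:
  "C2_warping (\<lambda>x. f (- x)) (\<lambda>x. - f' (- x)) (\<lambda>x. f'' (- x)) (- b) (- a)"
proof
  fix x assume "x \<in> einterval (- b) (- a)"
  then have x: "- x \<in> einterval a b"
    by (simp add: einterval_reflect)
  show "0 < f (- x)"
    using f_pos[OF x] .
  show "((\<lambda>x. f (- x)) has_real_derivative - f' (- x)) (at x)"
    by (rule DERIV_cong[OF DERIV_chain2[where g = uminus, OF f_deriv[OF x]]]) (auto intro!: derivative_eq_intros)
  have "((\<lambda>x. f' (- x)) has_real_derivative - f'' (- x)) (at x)"
    by (rule DERIV_cong[OF DERIV_chain2[where g = uminus, OF f'_deriv[OF x]]]) (auto intro!: derivative_eq_intros)
  from DERIV_minus[OF this] show "((\<lambda>x. - f' (- x)) has_real_derivative f'' (- x)) (at x)"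
    by simp
qed


section \<open>Condition (B)\<close>

text \<open>Every punctured neighbourhood of \<open>m\<close> contains a point where
  \<open>G\<close> is infinite, so every supremum in the definition of the upper limit is
  infinite.\<close>

lemma Limsup_at_eq_infinity:
  fixes G :: "real \<Rightarrow> ereal"
  assumes "\<And>e. 0 < e \<Longrightarrow> \<exists>D. m < D \<and> D < m + e \<and> G D = \<infinity>"
  shows "Limsup (at m) G = \<infinity>"
proof -
  have "\<infinity> \<le> (SUP x\<in>{x. P x}. G x)" if P: "eventually P (at m)" for P
  proof -
    obtain d where d: "0 < d" "\<And>x. x \<noteq> m \<Longrightarrow> dist x m < d \<Longrightarrow> P x"
      using P unfolding eventually_at by auto
    obtain D where D: "m < D" "D < m + d" "G D = \<infinity>"
      using assms[OF d(1)] by blast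
    then have "P D"
      by (intro d(2)) (auto simp: dist_real_def)
    then show ?thesis
      using D(3) by (metis SUP_upper mem_Collect_eq)
  qed
  then have "\<infinity> \<le> Limsup (at m) G"
    unfolding Limsup_def by (intro INF_greatest) auto
  then show ?thesis by simp
qed

context C2_warping
begin

text \<open>Degenerate turning points provide energies arbitrarily close to the lower limit with
  infinite travel time. Subtracting the finite \<open>travel_to_b f b c\<close> leaves the upper
  limit infinite.\<close>

lemma d_b_at_eq_infinity:
  assumes close: "close_to_b f a b c" and fin: "travel_to_b f b c < \<infinity>"
    and nonpos: "\<And>s. ereal s < b \<Longrightarrow> \<exists>x>s. ereal x < b \<and> f' x \<le> 0"
  shows "d_b_at f a b c = \<infinity>"
proof -
  let ?m = "real_of_ereal (m_b f b)"
  have "Limsup (at ?m) (\<lambda>D. enn2ereal (travel f D (ereal c) (b_star f a b c D))) = \<infinity>"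
  proof (rule Limsup_at_eq_infinity)
    fix e :: real assume "0 < e"
    then obtain t K \<delta> where t: "c < t" "t \<in> einterval a b" "inv_sq f t < ?m + e" "?m < inv_sq f t"
        "\<And>x. c \<le> x \<Longrightarrow> x < t \<Longrightarrow> inv_sq f t < inv_sq f x" and K: "0 < K" "0 < \<delta>"
        "\<And>x. \<bar>x - t\<bar> < \<delta> \<Longrightarrow> \<bar>inv_sq f x - inv_sq f t\<bar> \<le> K * (x - t)\<^sup>2"
      using degenerate_turning_point[OF close nonpos] by metis
    have first: "ereal t \<le> y" if "y \<in> A_plus f a b c (inv_sq f t)" for y
      using that t(2,5) by (force simp: A_plus_def einterval_iff not_less[symmetric])
    have mem: "ereal t \<in> A_plus f a b c (inv_sq f t)" "ereal t \<noteq> ereal c"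
      using t(1,2) by (auto simp: A_plus_def)
    \<comment> \<open>Since \<open>t\<close> differs from \<open>c\<close>, it is the least element
      of the set with or without \<open>c\<close>; both branches of \<open>b_star\<close> therefore
      give \<open>t\<close>.\<close>
    have "b_star f a b c (inv_sq f t) = ereal t"
      unfolding b_star_def using first mem by (auto intro!: Least_equality)
    moreover have "travel f (inv_sq f t) (ereal c) (ereal t) = \<infinity>"
    \<comment> \<open>The singularity is approached from the left; the cap \<open>t - c\<close>
      keeps the points inside the interval of integration.\<close>
    proof (rule travel_eq_infinity[where \<sigma> = "- 1" and t = t and \<delta> = "min \<delta> (t - c)" and K = K])
      show "0 < inv_sq f t"
        using inv_sq_pos[OF t(2)] .
      fix x assume "0 < - 1 * (x - t)" "- 1 * (x - t) < min \<delta> (t - c)"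
      then show "x \<in> einterval (ereal c) (ereal t) \<and> inv_sq f t < inv_sq f x \<and>
          inv_sq f x - inv_sq f t \<le> K * (x - t)\<^sup>2"
        using t(5)[of x] K(3)[of x] by auto
    qed (use K t in auto)
    ultimately show "\<exists>D. ?m < D \<and> D < ?m + e \<and>
        enn2ereal (travel f D (ereal c) (b_star f a b c D)) = \<infinity>"
      using t(3,4) by auto
  qed
  then show ?thesis
    unfolding d_b_at_def using fin by (cases "travel_to_b f b c") auto
qed

text \<open>Only the turning point is obtained by reflection. The values of \<open>a_star\<close>
  and \<open>travel\<close> are then computed directly at its mirror image, so neither has to be
  reflected.\<close>

lemma d_a_at_eq_infinity:
  assumes close: "close_to_a f a b c" and fin: "travel_to_a f a c < \<infinity>"
    and nonneg: "\<And>s. a < ereal s \<Longrightarrow> \<exists>x<s. a < ereal x \<and> 0 \<le> f' x"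
  shows "d_a_at f a b c = \<infinity>"
proof -
  interpret r: C2_warping "\<lambda>x. f (- x)" "\<lambda>x. - f' (- x)" "\<lambda>x. f'' (- x)" "- b" "- a"
    by (rule reflect)
  let ?m = "real_of_ereal (m_a f a)"
  have nonpos: "\<exists>x>s. ereal x < - a \<and> - f' (- x) \<le> 0" if "ereal s < - a" for s
  proof -
    have "a < ereal (- s)"
      using that by (cases a) auto
    from nonneg[OF this] obtain x where "x < - s" "a < ereal x" "0 \<le> f' x"
      by blast
    then show ?thesis
      by (intro exI[of _ "- x"]) (cases a; auto)
  qed
  have "Limsup (at ?m) (\<lambda>D. enn2ereal (travel f D (a_star f a b c D) (ereal c))) = \<infinity>"
  proof (rule Limsup_at_eq_infinity)
    fix e :: real assume "0 < e"
    then obtain u K \<delta> where u: "- c < u" "u \<in> einterval (- b) (- a)" "inv_sq f (- u) < ?m + e"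
        "?m < inv_sq f (- u)" "\<And>x. - c \<le> x \<Longrightarrow> x < u \<Longrightarrow> inv_sq f (- u) < inv_sq f (- x)"
      and K: "0 < K" "0 < \<delta>"
        "\<And>x. \<bar>x - u\<bar> < \<delta> \<Longrightarrow> \<bar>inv_sq f (- x) - inv_sq f (- u)\<bar> \<le> K * (x - u)\<^sup>2"
      using r.degenerate_turning_point[OF close_to_reflect[THEN iffD2, OF close] nonpos,
          unfolded m_b_reflect inv_sq_reflect] by metis
    define t where "t = - u"
    have t: "t < c" "t \<in> einterval a b" "inv_sq f t < ?m + e" "?m < inv_sq f t"
        "\<And>x. x \<le> c \<Longrightarrow> t < x \<Longrightarrow> inv_sq f t < inv_sq f x"
      using u(1-4) u(5)[of "- _"] by (auto simp: t_def einterval_reflect)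
    have K': "\<bar>inv_sq f x - inv_sq f t\<bar> \<le> K * (x - t)\<^sup>2" if "\<bar>x - t\<bar> < \<delta>" for x
      using K(3)[of "- x"] that power2_commute[of x "- u"] by (simp add: t_def power2_eq_square algebra_simps)
    have last: "y \<le> ereal t" if "y \<in> A_minus f a b c (inv_sq f t)" for y
      using that t(2,5) by (force simp: A_minus_def einterval_iff not_less[symmetric])
    have mem: "ereal t \<in> A_minus f a b c (inv_sq f t)" "ereal t \<noteq> ereal c"
      using t(1,2) by (auto simp: A_minus_def)
    have "a_star f a b c (inv_sq f t) = ereal t"
      unfolding a_star_def using last mem by (auto intro!: Greatest_equality)
    moreover have "travel f (inv_sq f t) (ereal t) (ereal c) = \<infinity>"
    proof (rule travel_eq_infinity[where \<sigma> = 1 and t = t and \<delta> = "min \<delta> (c - t)" and K = K])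
      show "0 < inv_sq f t"
        using inv_sq_pos[OF t(2)] .
      fix x assume "0 < 1 * (x - t)" "1 * (x - t) < min \<delta> (c - t)"
      then show "x \<in> einterval (ereal t) (ereal c) \<and> inv_sq f t < inv_sq f x \<and>
          inv_sq f x - inv_sq f t \<le> K * (x - t)\<^sup>2"
        using t(5)[of x] K'[of x] by auto
    qed (use K t in auto)
    ultimately show "\<exists>D. ?m < D \<and> D < ?m + e \<and>
        enn2ereal (travel f D (a_star f a b c D) (ereal c)) = \<infinity>"
      using t(3,4) by auto
  qed
  then show ?thesis
    unfolding d_a_at_def using fin by (cases "travel_to_a f a c") auto
qed

text \<open>Otherwise \<open>f' x \<le> 0\<close> occurs arbitrarily close to \<open>b\<close>,
  which makes \<open>d_b\<close> infinite; then \<open>2 * d_b\<close> dominates every diameter and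
  Condition (B) holds.\<close>

lemma increasing_near_b:
  assumes "\<not> condition_B_at_b f a b d"
  obtains s where "a \<le> ereal s" "ereal s < b" "\<And>x. s < x \<Longrightarrow> ereal x < b \<Longrightarrow> 0 < f' x"
proof (rule ccontr)
  assume "\<not> thesis"
  with that have no: "\<nexists>s. a \<le> ereal s \<and> ereal s < b \<and> (\<forall>x>s. ereal x < b \<longrightarrow> 0 < f' x)"
    by blast
  obtain s where s: "min_threshold_b f a b s"
    using assms by (auto simp: condition_B_at_b_def reaches_relative_min_b_def)
  have "\<exists>c. c \<in> einterval (ereal s) b"
    using s by (intro einterval_nonempty) (auto simp: min_threshold_b_def)
  then obtain c0 where c0: "close_to_b f a b c0"
    using s by (auto simp: close_to_b_def)
  \<comment> \<open>This is the base point selected in \<open>d_b\<close>. It is admissible because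
    failure of the second alternative of Condition (B) makes the travel time finite from every close
    base point.\<close>
  define c where "c = (SOME c. close_to_b f a b c \<and> travel_to_b f b c < \<infinity>)"
  have "close_to_b f a b c0 \<and> travel_to_b f b c0 < \<infinity>"
    using c0 assms by (auto simp: condition_B_at_b_def less_top)
  then have c: "close_to_b f a b c" "travel_to_b f b c < \<infinity>"
    unfolding c_def by (metis (mono_tags, lifting) someI_ex)+
  have "\<exists>x>r. ereal x < b \<and> f' x \<le> 0" if "ereal r < b" for r
  proof -
    \<comment> \<open>The threshold \<open>s\<close> guarantees the bound by \<open>a\<close> that
      is needed to apply \<open>no\<close>.\<close>
    have "a \<le> ereal (max s r)" "ereal (max s r) < b"
      using s that by (auto simp: min_threshold_b_def max_def intro: order_trans)
    then obtain x where "x > max s r" "ereal x < b" "\<not> 0 < f' x"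
      using no by blast
    then show ?thesis by auto
  qed
  then have "d_b f a b = \<infinity>"
    unfolding d_b_def c_def[symmetric] using d_b_at_eq_infinity[OF c] by blast
  then show False
    using assms by (simp add: condition_B_at_b_def)
qed

lemma decreasing_near_a:
  assumes "\<not> condition_B_at_a f a b d"
  obtains s where "ereal s \<le> b" "a < ereal s" "\<And>x. x < s \<Longrightarrow> a < ereal x \<Longrightarrow> f' x < 0"
proof (rule ccontr)
  assume "\<not> thesis"
  with that have no: "\<nexists>s. ereal s \<le> b \<and> a < ereal s \<and> (\<forall>x<s. a < ereal x \<longrightarrow> f' x < 0)"
    by blast
  obtain s where s: "min_threshold_a f a b s"
    using assms by (auto simp: condition_B_at_a_def reaches_relative_min_a_def)
  have "\<exists>c. c \<in> einterval a (ereal s)"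
    using s by (intro einterval_nonempty) (auto simp: min_threshold_a_def)
  then obtain c0 where c0: "close_to_a f a b c0"
    using s by (auto simp: close_to_a_def)
  define c where "c = (SOME c. close_to_a f a b c \<and> travel_to_a f a c < \<infinity>)"
  have "close_to_a f a b c0 \<and> travel_to_a f a c0 < \<infinity>"
    using c0 assms by (auto simp: condition_B_at_a_def less_top)
  then have c: "close_to_a f a b c" "travel_to_a f a c < \<infinity>"
    unfolding c_def by (metis (mono_tags, lifting) someI_ex)+
  have "\<exists>x<r. a < ereal x \<and> 0 \<le> f' x" if "a < ereal r" for r
  proof -
    have "ereal (min s r) \<le> b" "a < ereal (min s r)"
      using s that by (auto simp: min_threshold_a_def min_def intro: order_trans[of "ereal r" "ereal s"])
    then obtain x where "x < min s r" "a < ereal x" "\<not> f' x < 0"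
      using no by blast
    then show ?thesis by auto
  qed
  then have "d_a f a b = \<infinity>"
    unfolding d_a_def c_def[symmetric] using d_a_at_eq_infinity[OF c] by blast
  then show False
    using assms by (simp add: condition_B_at_a_def)
qed

section \<open>Existence of the limits of the warping function\<close>

lemma limit_at_b:
  assumes s: "a \<le> ereal s" "ereal s < b" "\<And>x. s < x \<Longrightarrow> ereal x < b \<Longrightarrow> 0 < f' x"
  shows "\<exists>L::ereal. 0 < L \<and> ((\<lambda>\<tau>. ereal (f (real_of_ereal \<tau>))) \<longlongrightarrow> L) (at_left b)"
proof -
  let ?J = "einterval (ereal s) b"
  \<comment> \<open>For an increasing function the limit is the supremum, which may be infinite and
    is positive because it dominates a value of \<open>f\<close>.\<close>
  define L where "L = (SUP x\<in>?J. ereal (f x))"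
  have sub: "x \<in> einterval a b" if "x \<in> ?J" for x
    using that s(1) by (auto simp: einterval_iff intro: le_less_trans)
  have mono: "f x < f y" if "x \<in> ?J" "y \<in> ?J" "x < y" for x y
  proof (rule DERIV_pos_imp_increasing[OF that(3)])
    fix z assume "x \<le> z" "z \<le> y"
    then have "ereal x \<le> ereal z" "ereal z \<le> ereal y"
      by auto
    then have "z \<in> ?J"
      using that(1,2) unfolding einterval_iff by (meson le_less_trans less_le_trans)
    then show "\<exists>d. (f has_real_derivative d) (at z) \<and> 0 < d"
      using f_deriv[OF sub] s(3)[of z] by (auto simp: einterval_iff)
  qed
  \<comment> \<open>Extended reals strictly between \<open>s\<close> and \<open>b\<close> are
    finite, so \<open>real_of_ereal\<close> is faithful on them.\<close>
  have J: "real_of_ereal \<tau> \<in> ?J" "ereal (real_of_ereal \<tau>) = \<tau>" if "ereal s < \<tau>" "\<tau> < b" for \<tau>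
    using that by (cases \<tau>; auto simp: einterval_iff)+
  obtain x0 where x0: "x0 \<in> ?J"
    using einterval_nonempty[OF s(2)] by blast
  have "0 < ereal (f x0)"
    using f_pos[OF sub[OF x0]] by simp
  also have "\<dots> \<le> L"
    unfolding L_def by (rule SUP_upper[OF x0])
  finally have "0 < L" .
  moreover have "((\<lambda>\<tau>. ereal (f (real_of_ereal \<tau>))) \<longlongrightarrow> L) (at_left b)"
  proof (rule order_tendstoI)
    fix l assume "l < L"
    then obtain x where x: "x \<in> ?J" "l < ereal (f x)"
      unfolding L_def less_SUP_iff by blast
    have "l < ereal (f (real_of_ereal \<tau>))" if "ereal x < \<tau>" "\<tau> < b" for \<tau>
    proof -
      have *: "ereal s < \<tau>"
        using x(1) that(1) by (auto simp: einterval_iff intro: less_trans[of "ereal s" "ereal x"])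
      have "f x < f (real_of_ereal \<tau>)"
        using J[OF * that(2)] that(1) x(1) by (intro mono) (auto simp flip: less_ereal.simps(1))
      then show ?thesis
        using x(2) by (auto intro: less_trans)
    qed
    then show "\<forall>\<^sub>F \<tau> in at_left b. l < ereal (f (real_of_ereal \<tau>))"
      using x(1) by (subst eventually_at_left[OF s(2)]) (auto simp: einterval_iff intro!: exI[of _ "ereal x"])
  next
    fix l assume "L < l"
    have "ereal (f (real_of_ereal \<tau>)) < l" if "ereal s < \<tau>" "\<tau> < b" for \<tau>
      using J[OF that] \<open>L < l\<close> unfolding L_def by (metis SUP_upper le_less_trans)
    then show "\<forall>\<^sub>F \<tau> in at_left b. ereal (f (real_of_ereal \<tau>)) < l"
      using s(2) by (subst eventually_at_left[OF s(2)]) (auto intro!: exI[of _ "ereal s"])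
  qed
  ultimately show ?thesis by blast
qed

lemma limit_at_a:
  assumes s: "ereal s \<le> b" "a < ereal s" "\<And>x. x < s \<Longrightarrow> a < ereal x \<Longrightarrow> f' x < 0"
  shows "\<exists>L::ereal. 0 < L \<and> ((\<lambda>\<tau>. ereal (f (real_of_ereal \<tau>))) \<longlongrightarrow> L) (at_right a)"
proof -
  interpret r: C2_warping "\<lambda>x. f (- x)" "\<lambda>x. - f' (- x)" "\<lambda>x. f'' (- x)" "- b" "- a"
    by (rule reflect)
  have "\<exists>L::ereal. 0 < L \<and> ((\<lambda>\<tau>. ereal (f (- real_of_ereal \<tau>))) \<longlongrightarrow> L) (at_left (- a))"
  proof (rule r.limit_at_b[of "- s"])
    show "- b \<le> ereal (- s)"
      using s(1) by (cases b) auto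
    show "ereal (- s) < - a"
      using s(2) by (cases a) auto
    show "0 < - f' (- x)" if "- s < x" "ereal x < - a" for x
      using s(3)[of "- x"] that by (cases a) auto
  qed
  then show ?thesis
    unfolding at_right_ereal_eq filterlim_filtermap by simp
qed

end

section \<open>From smoothness to real derivatives\<close>

lemma higher_differentiable_on_SucD:
  fixes f :: "real \<Rightarrow> real"
  assumes "higher_differentiable_on S f (Suc n)" "x \<in> S"
  shows "(f has_real_derivative frechet_derivative f (at x) 1) (at x)"
proof -
  have "(f has_derivative frechet_derivative f (at x)) (at x)"
    using assms by (simp add: frechet_derivative_works)
  then show ?thesis
    by (metis differentiableI frechet_derivative_at has_field_derivative_def has_real_derivative_iff mult.right_neutral)
qed

lemma smooth_on_C2_warping:
  assumes "smooth_on (einterval a b) f" "\<And>\<tau>. \<tau> \<in> einterval a b \<Longrightarrow> 0 < f \<tau>"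
  obtains f'' where "C2_warping f (deriv f) f'' a b"
proof -
  let ?f' = "\<lambda>x. frechet_derivative f (at x) 1"
  have f: "higher_differentiable_on (einterval a b) f (Suc (Suc 0))"
    using assms(1) unfolding smooth_on_def by blast
  then have f': "higher_differentiable_on (einterval a b) ?f' (Suc 0)"
    by simp
  have deriv: "?f' x = deriv f x" if "x \<in> einterval a b" for x
    using DERIV_imp_deriv[OF higher_differentiable_on_SucD[OF f that]] by simp
  have "C2_warping f (deriv f) (\<lambda>x. frechet_derivative ?f' (at x) 1) a b"
  proof
    fix x assume x: "x \<in> einterval a b"
    show "0 < f x"
      using assms(2)[OF x] .
    show "(f has_real_derivative deriv f x) (at x)"
      using higher_differentiable_on_SucD[OF f x] deriv[OF x] by simp
    \<comment> \<open>The two forms of the first derivative are known to agree on the open interval,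
      which is a neighbourhood of \<open>x\<close>; this suffices to transfer the second
      derivative.\<close>
    have "\<forall>\<^sub>F y in nhds x. ?f' y = deriv f y"
      using eventually_nhds_in_open[OF open_einterval x] by eventually_elim (rule deriv)
    from DERIV_cong_ev[OF refl this refl] show "(deriv f has_real_derivative frechet_derivative ?f' (at x) 1) (at x)"
      using higher_differentiable_on_SucD[OF f' x] by blast
  qed
  then show thesis
    by (rule that)
qed

theorem lemma3:
  fixes X :: "'p topology"
    and \<A> :: "('p, 'e::euclidean_space) chart set"
    and g :: "('p, 'e) chart \<Rightarrow> 'e \<Rightarrow> 'e \<Rightarrow> 'e \<Rightarrow> real"
    and f :: "real \<Rightarrow> real"
    and a b :: ereal
  assumes "connected_riemannian_manifold X \<A> g"
    and "0 < riemannian_diam X \<A> g"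
    and "a < b"
    and "smooth_on (einterval a b) f"
    and "\<And>\<tau>. \<tau> \<in> einterval a b \<Longrightarrow> 0 < f \<tau>"
  shows
    "(\<not> condition_B_at_b f a b (riemannian_diam X \<A> g) \<longrightarrow>
        (\<exists>L::ereal. 0 < L \<and> ((\<lambda>\<tau>. ereal (f (real_of_ereal \<tau>))) \<longlongrightarrow> L) (at_left b)) \<and>
        (b < \<infinity> \<longrightarrow> (\<exists>\<delta>>0. \<forall>\<tau>\<in>einterval (b - ereal \<delta>) b. \<tau> \<in> einterval a b \<and> deriv f \<tau> > 0)) \<and>
        (b = \<infinity> \<longrightarrow> (\<exists>M>0. \<forall>\<tau>>M. \<tau> \<in> einterval a b \<and> deriv f \<tau> > 0))) \<and>
     (\<not> condition_B_at_a f a b (riemannian_diam X \<A> g) \<longrightarrow>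
        (\<exists>L::ereal. 0 < L \<and> ((\<lambda>\<tau>. ereal (f (real_of_ereal \<tau>))) \<longlongrightarrow> L) (at_right a)) \<and>
        (a > -\<infinity> \<longrightarrow> (\<exists>\<delta>>0. \<forall>\<tau>\<in>einterval a (a + ereal \<delta>). \<tau> \<in> einterval a b \<and> deriv f \<tau> < 0)) \<and>
        (a = -\<infinity> \<longrightarrow> (\<exists>M>0. \<forall>\<tau>. \<tau> < - M \<longrightarrow> \<tau> \<in> einterval a b \<and> deriv f \<tau> < 0)))"
proof (intro conjI impI)
  obtain f'' where "C2_warping f (deriv f) f'' a b"
    using smooth_on_C2_warping[OF assms(4,5)] .
  then interpret C2_warping f "deriv f" f'' a b .
  {
    assume B: "\<not> condition_B_at_b f a b (riemannian_diam X \<A> g)"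
    obtain s where s: "a \<le> ereal s" "ereal s < b"
        "\<And>x. s < x \<Longrightarrow> ereal x < b \<Longrightarrow> 0 < deriv f x"
      using increasing_near_b[OF B] by blast
    have near: "\<tau> \<in> einterval a b \<and> deriv f \<tau> > 0" if "s < \<tau>" "ereal \<tau> < b" for \<tau>
      using s that by (auto simp: einterval_iff intro: le_less_trans)
    show "\<exists>L::ereal. 0 < L \<and> ((\<lambda>\<tau>. ereal (f (real_of_ereal \<tau>))) \<longlongrightarrow> L) (at_left b)"
      by (rule limit_at_b[OF s])
    show "\<exists>\<delta>>0. \<forall>\<tau>\<in>einterval (b - ereal \<delta>) b. \<tau> \<in> einterval a b \<and> deriv f \<tau> > 0" if fin: "b < \<infinity>"
    proof -
      obtain r where r: "b = ereal r"
        using fin s(2) by (cases b) auto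
      show ?thesis
        \<comment> \<open>With this choice \<open>b - \<delta>\<close> is exactly
          \<open>s\<close>.\<close>
        using near s(2) by (intro exI[of _ "r - s"]) (auto simp: r)
    qed
    show "\<exists>M>0. \<forall>\<tau>>M. \<tau> \<in> einterval a b \<and> deriv f \<tau> > 0" if "b = \<infinity>"
      \<comment> \<open>The maximum with 1 makes \<open>M\<close> positive.\<close>
      using near that by (intro exI[of _ "max s 1"]) auto
  }
  {
    assume B: "\<not> condition_B_at_a f a b (riemannian_diam X \<A> g)"
    obtain s where s: "ereal s \<le> b" "a < ereal s"
        "\<And>x. x < s \<Longrightarrow> a < ereal x \<Longrightarrow> deriv f x < 0"
      using decreasing_near_a[OF B] by blast
    have near: "\<tau> \<in> einterval a b \<and> deriv f \<tau> < 0" if "\<tau> < s" "a < ereal \<tau>" for \<tau>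
      using s that by (auto simp: einterval_iff intro: less_le_trans[of "ereal \<tau>" "ereal s"])
    show "\<exists>L::ereal. 0 < L \<and> ((\<lambda>\<tau>. ereal (f (real_of_ereal \<tau>))) \<longlongrightarrow> L) (at_right a)"
      by (rule limit_at_a[OF s])
    show "\<exists>\<delta>>0. \<forall>\<tau>\<in>einterval a (a + ereal \<delta>). \<tau> \<in> einterval a b \<and> deriv f \<tau> < 0" if fin: "a > -\<infinity>"
    proof -
      obtain r where r: "a = ereal r"
        using fin s(2) by (cases a) auto
      show ?thesis
        using near s(2) by (intro exI[of _ "s - r"]) (auto simp: r)
    qed
    show "\<exists>M>0. \<forall>\<tau>. \<tau> < - M \<longrightarrow> \<tau> \<in> einterval a b \<and> deriv f \<tau> < 0" if "a = -\<infinity>"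
      using near that by (intro exI[of _ "max (- s) 1"]) auto
  }
qed

end
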